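(* Let $\Sigma$ be a signed graph with $n$ vertices and $m$ edges, with Laplacian eigenvalues $\lambda_1^L,\ldots,\lambda_{n-b(\Sigma)}^L>0$ and $\lambda_{n-b(\Sigma)+1}^L=\cdots=\lambda_n^L=0$. The eigenvalues of the line graph $\Lambda(\Sigma)$ are $2-\lambda_1^L,\ldots,2-\lambda_{n-b(\Sigma)}^L$, all $<2$, together with the eigenvalue $2$ with multiplicity $m-n+b(\Sigma)$. Its energy is $$E(\Lambda(\Sigma))=\sum_{i=1}^{n-b(\Sigma)}|\lambda_i^L-2|+2\big(m-n+b(\Sigma)\big).$$
   Context: All graphs are finite, simple and loop-free. A signed graph $\Sigma=(G,\sigma)$ is a graph $G=(V,E)$ with a function $\sigma:E\to\{+1,-1\}$. The sign of a cycle is the product of its edge signs; a signed graph is balanced if every cycle is positive. $b(\Sigma)$ is the number of connected components of $\Sigma$ that are balanced. The adjacency matrix $A(\Sigma)$ has $(u,v)$ entry $\sigma(uv)$ if $u,v$ are adjacent and $0$ otherwise; its eigenvalues are the eigenvalues of $\Sigma$, and the energy $E(\Sigma)$ is the sum of their absolute values. The Laplacian matrix is $L(\Sigma)=D(\Sigma)-A(\Sigma)$, where $D(\Sigma)$ is the diagonal matrix of vertex degrees in $G$; its eigenvalues are the Laplacian eigenvalues. It is known that $L(\Sigma)$ is positive semidefinite of rank $n-b(\Sigma)$. Incidence matrix: an $n\times m$ matrix $H(\Sigma)=[\eta_{ik}]$ with $\eta_{ik}=0$ if vertex $v_i$ is not incident with edge $e_k$, $\eta_{ik}=\pm1$ if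 it is, and $\eta_{ik}\eta_{jk}=-\sigma(v_iv_j)$ for each edge $e_k=v_iv_j$. It is unique up to multiplying columns by $-1$. Line graph: $\Lambda(\Sigma)$ is the signed graph whose underlying graph is the ordinary line graph of $G$ (vertices are the $m$ edges of $G$, adjacent when they share an endpoint), with signature given by the adjacency matrix $A(\Lambda(\Sigma))=2I_m-H(\Sigma)^{\mathrm T}H(\Sigma)$. (With this signature every cycle of $\Sigma$ becomes a cycle of the same sign in $\Lambda(\Sigma)$, and any three edges at a common vertex become a negative triangle. Changing the choice of $H(\Sigma)$ conjugates the matrix by a diagonal $\pm1$ matrix, which does not affect eigenvalues.) *)

theory Defs
  imports
    "Jordan_Normal_Form.Char_Poly"
    "HOL-Computational_Algebra.Computational_Algebra"
begin

record 'a sgraph =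
  verts :: "'a set"
  edges :: "'a set set"
  sgn_of :: "'a set \<Rightarrow> real"

text \<open>Edges are two-element sets of vertices, so loops and multiple edges are excluded.
  The values of \<^const>\<open>sgn_of\<close> outside \<^const>\<open>edges\<close> are irrelevant.\<close>

definition signed_graph :: "'a sgraph \<Rightarrow> bool" where
  "signed_graph S \<longleftrightarrow> finite (verts S) \<and>
     (\<forall>e\<in>edges S. e \<subseteq> verts S \<and> card e = 2 \<and> sgn_of S e \<in> {1, -1})"

definition enumerates :: "'b list \<Rightarrow> 'b set \<Rightarrow> bool" where
  "enumerates xs X \<longleftrightarrow> distinct xs \<and> set xs = X"


definition components :: "'a sgraph \<Rightarrow> 'a set set" where
  "components S = verts S //
     {(u, v). u \<in> verts S \<and> v \<in> verts S \<and> (u, v) \<in> {(x, y). {x, y} \<in> edges S}\<^sup>*}"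

definition induced :: "'a sgraph \<Rightarrow> 'a set \<Rightarrow> 'a sgraph" where
  "induced S C = \<lparr>verts = C, edges = {e \<in> edges S. e \<subseteq> C}, sgn_of = sgn_of S\<rparr>"

definition cycle_edge :: "'a list \<Rightarrow> nat \<Rightarrow> 'a set" where
  "cycle_edge c i = {c ! i, c ! (Suc i mod length c)}"

definition is_cycle :: "'a sgraph \<Rightarrow> 'a list \<Rightarrow> bool" where
  "is_cycle S c \<longleftrightarrow> 3 \<le> length c \<and> distinct c \<and> (\<forall>i<length c. cycle_edge c i \<in> edges S)"

definition cycle_sign :: "'a sgraph \<Rightarrow> 'a list \<Rightarrow> real" where
  "cycle_sign S c = (\<Prod>i<length c. sgn_of S (cycle_edge c i))"

definition balanced :: "'a sgraph \<Rightarrow> bool" where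
  "balanced S \<longleftrightarrow> (\<forall>c. is_cycle S c \<longrightarrow> cycle_sign S c = 1)"

definition num_balanced_components :: "'a sgraph \<Rightarrow> nat" where
  "num_balanced_components S = card {C \<in> components S. balanced (induced S C)}"


text \<open>Matrices of a signed graph are taken with respect to an enumeration \<open>vs\<close> of its vertices
  and, where needed, an enumeration \<open>es\<close> of its edges.\<close>

definition adjacency_mat :: "'a sgraph \<Rightarrow> 'a list \<Rightarrow> real mat" where
  "adjacency_mat S vs = mat (length vs) (length vs)
     (\<lambda>(i, j). if {vs ! i, vs ! j} \<in> edges S then sgn_of S {vs ! i, vs ! j} else 0)"

definition degree_mat :: "'a sgraph \<Rightarrow> 'a list \<Rightarrow> real mat" where
  "degree_mat S vs = mat (length vs) (length vs)
     (\<lambda>(i, j). if i = j then real (card {e \<in> edges S. vs ! i \<in> e}) else 0)"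

definition laplacian_mat :: "'a sgraph \<Rightarrow> 'a list \<Rightarrow> real mat" where
  "laplacian_mat S vs = degree_mat S vs - adjacency_mat S vs"

text \<open>Eigenvalues with algebraic multiplicity. The matrices above are real symmetric, so no
  eigenvalue is lost by taking only the real roots of the characteristic polynomial.\<close>

definition eigenvalues_of :: "real mat \<Rightarrow> real multiset" where
  "eigenvalues_of A = proots (char_poly A)"

definition energy :: "'a sgraph \<Rightarrow> 'a list \<Rightarrow> real" where
  "energy S vs = (\<Sum>x\<in>#eigenvalues_of (adjacency_mat S vs). \<bar>x\<bar>)"


text \<open>\<open>\<eta> v e\<close> is the entry of the incidence matrix at vertex \<open>v\<close> and edge \<open>e\<close>.\<close>

definition is_incidence :: "'a sgraph \<Rightarrow> ('a \<Rightarrow> 'a set \<Rightarrow> real) \<Rightarrow> bool" where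
  "is_incidence S \<eta> \<longleftrightarrow>
     (\<forall>v\<in>verts S. \<forall>e\<in>edges S.
        (v \<notin> e \<longrightarrow> \<eta> v e = 0) \<and> (v \<in> e \<longrightarrow> \<eta> v e \<in> {1, -1})) \<and>
     (\<forall>u v. {u, v} \<in> edges S \<longrightarrow> \<eta> u {u, v} * \<eta> v {u, v} = - sgn_of S {u, v})"

definition incidence_mat :: "('a \<Rightarrow> 'a set \<Rightarrow> real) \<Rightarrow> 'a list \<Rightarrow> 'a set list \<Rightarrow> real mat" where
  "incidence_mat \<eta> vs es = mat (length vs) (length es) (\<lambda>(i, k). \<eta> (vs ! i) (es ! k))"

text \<open>For distinct edges \<open>e\<close> and \<open>f\<close> the sign of \<open>{e, f}\<close> is \<open>- (\<Sum>v. \<eta> v e * \<eta> v f)\<close>, the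
  corresponding off-diagonal entry of \<open>2I - H\<^sup>TH\<close>; see \<open>adjacency_mat_line_graph\<close> below.\<close>

definition line_graph :: "'a sgraph \<Rightarrow> ('a \<Rightarrow> 'a set \<Rightarrow> real) \<Rightarrow> 'a set sgraph" where
  "line_graph S \<eta> =
     \<lparr>verts = edges S,
      edges = {{e, f} | e f. e \<in> edges S \<and> f \<in> edges S \<and> e \<noteq> f \<and> e \<inter> f \<noteq> {}},
      sgn_of = (\<lambda>p. - (\<Sum>v\<in>verts S. \<Prod>e\<in>p. \<eta> v e))\<rparr>"


lemma is_incidence_exists:
  assumes "signed_graph S"
  shows "\<exists>\<eta>. is_incidence S \<eta>"
proof -
  define h where "h e = (SOME x. x \<in> e)" for e :: "'a set"
  define \<eta> where "\<eta> v e = (if v \<notin> e then 0 else if v = h e then 1 else - sgn_of S e)" for v e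
  have "is_incidence S \<eta>"
    unfolding is_incidence_def
  proof (intro conjI ballI allI impI)
    fix v e assume "v \<in> verts S" "e \<in> edges S" "v \<in> e"
    then show "\<eta> v e \<in> {1, -1}"
      using assms by (auto simp: \<eta>_def signed_graph_def)
  next
    fix u v assume uv: "{u, v} \<in> edges S"
    then have "u \<noteq> v" using assms by (auto simp: signed_graph_def)
    moreover have "h {u, v} \<in> {u, v}" unfolding h_def by (rule someI[of _ u]) simp
    ultimately show "\<eta> u {u, v} * \<eta> v {u, v} = - sgn_of S {u, v}"
      by (auto simp: \<eta>_def)
  qed (simp add: \<eta>_def)
  then show ?thesis by blast
qed

lemma edges_common:
  assumes "signed_graph S" "e \<in> edges S" "f \<in> edges S" "e \<noteq> f" "v \<in> e" "v \<in> f"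
  shows "e \<inter> f = {v}"
proof -
  have "card e = 2" "card f = 2" using assms by (auto simp: signed_graph_def)
  then obtain a b where "e = {v, a}" "f = {v, b}"
    using assms(5,6) by (auto simp: card_2_iff doubleton_eq_iff)
  then show ?thesis using assms(4) by auto
qed

lemma line_graph_sgn:
  assumes "signed_graph S" "is_incidence S \<eta>"
    and "e \<in> edges S" "f \<in> edges S" "e \<noteq> f"
  shows "sgn_of (line_graph S \<eta>) {e, f} = - (\<Sum>v\<in>verts S. \<eta> v e * \<eta> v f)"
    and "e \<inter> f = {} \<Longrightarrow> (\<Sum>v\<in>verts S. \<eta> v e * \<eta> v f) = 0"
    and "e \<inter> f \<noteq> {} \<Longrightarrow> (\<Sum>v\<in>verts S. \<eta> v e * \<eta> v f) \<in> {1, -1}"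
proof -
  show "sgn_of (line_graph S \<eta>) {e, f} = - (\<Sum>v\<in>verts S. \<eta> v e * \<eta> v f)"
    using assms(5) by (simp add: line_graph_def)
next
  assume "e \<inter> f = {}"
  then show "(\<Sum>v\<in>verts S. \<eta> v e * \<eta> v f) = 0"
    using assms by (intro sum.neutral) (auto simp: is_incidence_def)
next
  assume "e \<inter> f \<noteq> {}"
  then obtain w where w: "w \<in> e" "w \<in> f" by auto
  then have ef: "e \<inter> f = {w}" using edges_common[OF assms(1,3,4,5)] by blast
  have wV: "w \<in> verts S" and fin: "finite (verts S)"
    using assms w by (auto simp: signed_graph_def)
  have "(\<Sum>v\<in>verts S. \<eta> v e * \<eta> v f) = (\<Sum>v\<in>{w}. \<eta> v e * \<eta> v f)"
    using assms(2-4) ef wV fin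
    by (intro sum.mono_neutral_right) (auto simp: is_incidence_def)
  moreover have "\<eta> w e \<in> {1, -1}" "\<eta> w f \<in> {1, -1}"
    using assms(2-4) w wV by (auto simp: is_incidence_def)
  ultimately show "(\<Sum>v\<in>verts S. \<eta> v e * \<eta> v f) \<in> {1, -1}" by auto
qed

lemma signed_graph_line_graph:
  assumes "signed_graph S" "is_incidence S \<eta>"
  shows "signed_graph (line_graph S \<eta>)"
proof -
  have "edges S \<subseteq> Pow (verts S)" "finite (verts S)"
    using assms by (auto simp: signed_graph_def)
  then have "finite (verts (line_graph S \<eta>))"
    by (auto simp: line_graph_def intro: finite_subset)
  moreover have "p \<subseteq> verts (line_graph S \<eta>) \<and> card p = 2 \<and> sgn_of (line_graph S \<eta>) p \<in> {1, -1}"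
    if p: "p \<in> edges (line_graph S \<eta>)" for p
  proof -
    obtain e f where ef: "p = {e, f}" "e \<in> edges S" "f \<in> edges S" "e \<noteq> f" "e \<inter> f \<noteq> {}"
      using p by (auto simp: line_graph_def)
    have "sgn_of (line_graph S \<eta>) p \<in> {1, -1}"
      using line_graph_sgn(1,3)[OF assms ef(2-4)] ef(1,5) by auto
    then show ?thesis using ef by (auto simp: line_graph_def)
  qed
  ultimately show ?thesis by (simp add: signed_graph_def)
qed

lemma adjacency_mat_line_graph:
  assumes "signed_graph S" "is_incidence S \<eta>"
    and "enumerates vs (verts S)" "enumerates es (edges S)"
  shows "adjacency_mat (line_graph S \<eta>) es =
    2 \<cdot>\<^sub>m 1\<^sub>m (length es) - transpose_mat (incidence_mat \<eta> vs es) * incidence_mat \<eta> vs es"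
    (is "?A = ?B")
proof (rule eq_matI)
  have vs: "distinct vs" "set vs = verts S" and es: "distinct es" "set es = edges S"
    using assms by (auto simp: enumerates_def)
  fix k l assume "k < dim_row ?B" "l < dim_col ?B"
  then have k: "k < length es" and l: "l < length es" by (auto simp: incidence_mat_def)
  then have kE: "es ! k \<in> edges S" and lE: "es ! l \<in> edges S" using es nth_mem by blast+
  have "(\<Sum>i = 0..<length vs. \<eta> (vs ! i) (es ! k) * \<eta> (vs ! i) (es ! l))
      = (\<Sum>v\<in>verts S. \<eta> v (es ! k) * \<eta> v (es ! l))"
    using bij_betw_nth[OF vs(1), of "{0..<length vs}" "verts S"] vs
    by (intro sum.reindex_bij_betw) (auto simp: atLeast0LessThan)
  then have B: "?B $$ (k, l) = (if k = l then 2 else 0)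
      - (\<Sum>v\<in>verts S. \<eta> v (es ! k) * \<eta> v (es ! l))"
    using k l by (simp add: incidence_mat_def scalar_prod_def)
  show "?A $$ (k, l) = ?B $$ (k, l)"
  proof (cases "k = l")
    case True
    have fin: "finite (verts S)" and e: "es ! k \<subseteq> verts S" "card (es ! k) = 2"
      using assms kE by (auto simp: signed_graph_def)
    have "(\<Sum>v\<in>verts S. \<eta> v (es ! k) * \<eta> v (es ! k)) = (\<Sum>v\<in>es ! k. \<eta> v (es ! k) * \<eta> v (es ! k))"
      using assms(2) kE e fin by (intro sum.mono_neutral_right) (auto simp: is_incidence_def)
    also have "\<dots> = (\<Sum>v\<in>es ! k. 1)"
      using assms(2) kE e by (intro sum.cong) (force simp: is_incidence_def)+
    finally have "?B $$ (k, l) = 0" using B True e by simp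
    moreover have "{es ! k} \<notin> edges (line_graph S \<eta>)"
      by (auto simp: line_graph_def doubleton_eq_iff)
    ultimately show ?thesis using True k by (simp add: adjacency_mat_def)
  next
    case False
    then have ne: "es ! k \<noteq> es ! l" using es(1) k l by (simp add: nth_eq_iff_index_eq)
    have "{es ! k, es ! l} \<in> edges (line_graph S \<eta>) \<longleftrightarrow> es ! k \<inter> es ! l \<noteq> {}"
      using kE lE ne by (auto simp: line_graph_def doubleton_eq_iff)
    then show ?thesis
      using line_graph_sgn[OF assms(1,2) kE lE ne] False k l B by (auto simp: adjacency_mat_def)
  qed
qed (auto simp: adjacency_mat_def incidence_mat_def)

end

theory Submission
  imports Defs
begin

text \<open>With \<open>H\<close> the incidence matrix, \<open>L = H H\<^sup>T\<close> while the line graph has adjacency matrix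
  \<open>2 I - H\<^sup>T H\<close>. The characteristic polynomials of \<open>H H\<^sup>T\<close> and \<open>H\<^sup>T H\<close> agree up to a power of
  \<open>x\<close>, so only the multiplicity of \<open>0\<close> in \<open>L\<close> is at stake. A vector in the kernel of \<open>H\<^sup>T\<close> satisfies
  \<open>x\<^sub>u = \<sigma>(uv) x\<^sub>v\<close> along every edge; multiplying around a cycle, it vanishes on unbalanced components,
  and on a balanced one it is a multiple of the \<open>\<plusminus>1\<close> potential given by balance.\<close>

subsection \<open>Characteristic polynomials of products and of symmetric matrices\<close>

lemma poly_char_poly_det:
  fixes A :: "'a :: field mat"
  assumes A: "A \<in> carrier_mat n n"
  shows "poly (char_poly A) t = det (t \<cdot>\<^sub>m 1\<^sub>m n - A)"
  unfolding char_poly_def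
  by (rule poly_det_cong[of _ n], insert A, auto simp: char_poly_matrix_def)

text \<open>Both sides come from the one block matrix \<open>?M\<close>. Multiplying by
  \<open>?R\<close>, of determinant 1, on the right clears the lower left block and leaves the Schur
  complement tI - AB. Multiplying by \<open>?L\<close>, of determinant \<open>t ^ m\<close>, on the
  left clears the same block and leaves tI and tI - BA. No division by \<open>t\<close> occurs, so t
  = 0 is covered.\<close>

lemma det_mult_commute:
  fixes A B :: "'a :: idom mat"
  assumes A: "A \<in> carrier_mat n m" and B: "B \<in> carrier_mat m n"
  shows "t ^ m * det (t \<cdot>\<^sub>m 1\<^sub>m n - A * B) = t ^ n * det (t \<cdot>\<^sub>m 1\<^sub>m m - B * A)"
proof -
  let ?M = "four_block_mat (t \<cdot>\<^sub>m 1\<^sub>m n) A B (1\<^sub>m m)"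
  let ?R = "four_block_mat (1\<^sub>m n) (0\<^sub>m n m) (- B) (1\<^sub>m m)"
  let ?L = "four_block_mat (1\<^sub>m n) (0\<^sub>m n m) (- B) (t \<cdot>\<^sub>m 1\<^sub>m m)"
  have AB: "A * B \<in> carrier_mat n n" and BA: "B * A \<in> carrier_mat m m" using A B by auto
  have "?M * ?R = four_block_mat (t \<cdot>\<^sub>m 1\<^sub>m n - A * B) A (0\<^sub>m m n) (1\<^sub>m m)"
    by (subst mult_four_block_mat, insert A B AB, auto intro!: cong_four_block_mat)
  moreover have "det ?R = 1"
    by (subst det_four_block_mat_upper_right_zero[of _ n _ m], insert B, auto)
  moreover have "det (four_block_mat (t \<cdot>\<^sub>m 1\<^sub>m n - A * B) A (0\<^sub>m m n) (1\<^sub>m m))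
      = det (t \<cdot>\<^sub>m 1\<^sub>m n - A * B)"
    using det_four_block_mat_lower_left_zero[OF minus_carrier_mat[OF AB, of "t \<cdot>\<^sub>m 1\<^sub>m n"] A refl one_carrier_mat]
    by simp
  moreover have "det (?M * ?R) = det ?M * det ?R"
    by (rule det_mult[of _ "n + m"], insert A B, auto)
  ultimately have 1: "det ?M = det (t \<cdot>\<^sub>m 1\<^sub>m n - A * B)" by simp
  have "?L * ?M = four_block_mat (t \<cdot>\<^sub>m 1\<^sub>m n) A (0\<^sub>m m n) (t \<cdot>\<^sub>m 1\<^sub>m m - B * A)"
    by (subst mult_four_block_mat, insert A B BA, auto intro!: cong_four_block_mat)
  moreover have "det ?L = t ^ m"
    by (subst det_four_block_mat_upper_right_zero[of _ n _ m], insert B, auto)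
  moreover have "det (four_block_mat (t \<cdot>\<^sub>m 1\<^sub>m n) A (0\<^sub>m m n) (t \<cdot>\<^sub>m 1\<^sub>m m - B * A))
      = t ^ n * det (t \<cdot>\<^sub>m 1\<^sub>m m - B * A)"
    using det_four_block_mat_lower_left_zero[OF smult_carrier_mat[OF one_carrier_mat] A refl
        minus_carrier_mat[OF BA, of "t \<cdot>\<^sub>m 1\<^sub>m m"], of t]
    by simp
  moreover have "det (?L * ?M) = det ?L * det ?M"
    by (rule det_mult[of _ "n + m"], insert A B, auto)
  ultimately show ?thesis using 1 by simp
qed

text \<open>This is the determinant identity read pointwise. A field of characteristic zero is
  infinite, so agreement at every point gives equality of polynomials.\<close>

lemma char_poly_mult_commute:
  fixes A B :: "'a :: field_char_0 mat"
  assumes A: "A \<in> carrier_mat n m" and B: "B \<in> carrier_mat m n"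
  shows "monom 1 m * char_poly (A * B) = monom 1 n * char_poly (B * A)"
proof (rule poly_ext)
  fix t
  have AB: "A * B \<in> carrier_mat n n" and BA: "B * A \<in> carrier_mat m m" using A B by auto
  show "poly (monom 1 m * char_poly (A * B)) t = poly (monom 1 n * char_poly (B * A)) t"
    using det_mult_commute[OF A B, of t]
    by (simp add: poly_char_poly_det[OF AB] poly_char_poly_det[OF BA] poly_monom)
qed

text \<open>Since AB = 0, the product (tI - A)(tI - B) collapses to t(tI - (A + B)); the claim
  follows by taking determinants.\<close>

lemma char_poly_add_orthogonal:
  fixes A B :: "'a :: field_char_0 mat"
  assumes A: "A \<in> carrier_mat n n" and B: "B \<in> carrier_mat n n" and AB: "A * B = 0\<^sub>m n n"
  shows "char_poly A * char_poly B = monom 1 n * char_poly (A + B)"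
proof (rule poly_ext)
  fix t :: 'a
  let ?I = "t \<cdot>\<^sub>m 1\<^sub>m n"
  have "(?I - A) * (?I - B) = ?I * ?I - ?I * B - (A * ?I - A * B)"
    using A B minus_carrier_mat[OF B, of ?I]
    by (simp add: minus_mult_distrib_mat[of _ n n] mult_minus_distrib_mat[of _ n n _ n])
  also have "\<dots> = t \<cdot>\<^sub>m (?I - (A + B))"
    unfolding AB using A B by (intro eq_matI) (auto simp: algebra_simps)
  finally have "det (?I - A) * det (?I - B) = t ^ n * det (?I - (A + B))"
    using A B by (subst det_mult[symmetric, of _ n]) auto
  then show "poly (char_poly A * char_poly B) t = poly (monom 1 n * char_poly (A + B)) t"
    using A B by (simp add: poly_char_poly_det[of _ n] poly_monom)
qed

text \<open>The matrix tI - (cI - A) is the negative of (c - t)I - A, and the sign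
  \<open>(- 1) ^ n\<close> is that of the determinant. With c = 2 this handles the adjacency matrix
  of the line graph.\<close>

lemma char_poly_smult_one_minus:
  fixes A :: "'a :: field_char_0 mat"
  assumes A: "A \<in> carrier_mat n n"
  shows "char_poly (c \<cdot>\<^sub>m 1\<^sub>m n - A) = Polynomial.smult ((- 1) ^ n) (char_poly A \<circ>\<^sub>p [:c, - 1:])"
proof (rule poly_ext)
  fix t
  have "t \<cdot>\<^sub>m 1\<^sub>m n - (c \<cdot>\<^sub>m 1\<^sub>m n - A) = (- 1) \<cdot>\<^sub>m ((c - t) \<cdot>\<^sub>m 1\<^sub>m n - A)"
    using A by (intro eq_matI) (auto simp: algebra_simps)
  then have "det (t \<cdot>\<^sub>m 1\<^sub>m n - (c \<cdot>\<^sub>m 1\<^sub>m n - A)) = (- 1) ^ n * det ((c - t) \<cdot>\<^sub>m 1\<^sub>m n - A)"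
    using A by simp
  moreover have "c \<cdot>\<^sub>m 1\<^sub>m n - A \<in> carrier_mat n n" using A by (rule minus_carrier_mat)
  ultimately show "poly (char_poly (c \<cdot>\<^sub>m 1\<^sub>m n - A)) t
      = poly (Polynomial.smult ((- 1) ^ n) (char_poly A \<circ>\<^sub>p [:c, - 1:])) t"
    using A by (simp add: poly_char_poly_det[of _ n] poly_pcompose)
qed

section \<open>Real spectra of symmetric matrices, and reflection of roots\<close>

text \<open>For a complex eigenvector \<open>v\<close>, symmetry lets the matrix move to the other
  side of the product of \<open>v\<close> with its conjugate. The matrix is real, so this yields the
  factor \<open>z\<close> on one side and \<open>cnj z\<close> on the other, and
  \<open>v \<bullet>c v\<close> is nonzero.\<close>

lemma symmetric_complex_root_real:
  fixes A :: "real mat"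
  assumes A: "A \<in> carrier_mat n n" and sym: "transpose_mat A = A"
    and root: "poly (map_poly complex_of_real (char_poly A)) z = 0"
  shows "z \<in> \<real>"
proof -
  let ?A = "map_mat complex_of_real A"
  have cA: "?A \<in> carrier_mat n n" using A by simp
  have symc: "transpose_mat ?A = ?A" using sym A
    by (metis map_mat_transpose)
  have "eigenvalue ?A z"
    using root eigenvalue_root_char_poly[OF cA, of z]
    by (simp only: of_real_hom.char_poly_hom[OF A])
  then obtain v where v: "v \<in> carrier_vec n" "v \<noteq> 0\<^sub>v n" "?A *\<^sub>v v = z \<cdot>\<^sub>v v"
    using A by (auto simp: eigenvalue_def eigenvector_def)
  have cv: "conjugate v \<in> carrier_vec n" using v by simp
  have conj: "?A *\<^sub>v conjugate v = conjugate (?A *\<^sub>v v)"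
  proof (rule eq_vecI)
    fix i assume "i < dim_vec (conjugate (?A *\<^sub>v v))"
    then have i: "i < n" using A by simp
    have "conjugate (row ?A i) = row ?A i"
      using A i by (intro eq_vecI) auto
    then show "(?A *\<^sub>v conjugate v) $ i = conjugate (?A *\<^sub>v v) $ i"
      using A i v(1) conjugate_sprod_vec[of "row ?A i" n v] by simp
  qed (use A in simp)
  have "z * (v \<bullet>c v) = (?A *\<^sub>v v) \<bullet> conjugate v" using v cv by simp
  also have "\<dots> = v \<bullet> (?A *\<^sub>v conjugate v)"
    using transpose_vec_mult_scalar[OF cA cv v(1)] symc by simp
  also have "\<dots> = cnj z * (v \<bullet>c v)" using v cv unfolding conj v(3) by (simp add: conjugate_smult_vec)
  finally have "z = cnj z" using v by simp
  then show ?thesis by (metis Reals_cnj_iff)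
qed

text \<open>The fundamental theorem of algebra supplies a complex root; it is real by assumption, so
  a real linear factor splits off and induction on the degree applies.\<close>

lemma size_proots_real_if_complex_roots_real:
  fixes p :: "real poly"
  assumes "p \<noteq> 0" "\<And>z. poly (map_poly complex_of_real p) z = 0 \<Longrightarrow> z \<in> \<real>"
  shows "size (proots p) = degree p"
  using assms
proof (induction "degree p" arbitrary: p)
  case 0
  then show ?case using size_proots_le[of p] by simp
next
  case (Suc d)
  interpret H: map_poly_comm_ring_hom complex_of_real ..
  have "degree (map_poly complex_of_real p) = Suc d" using Suc(2) by simp
  then obtain z where z: "poly (map_poly complex_of_real p) z = 0"
    using fundamental_theorem_of_algebra[of "map_poly complex_of_real p"]
    by (auto simp: constant_degree)
  then obtain a where a: "z = complex_of_real a" using Suc(4) by (auto elim: Reals_cases)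
  have "poly p a = 0" using z unfolding a by simp
  then obtain q where q: "p = [:- a, 1:] * q" by (auto simp: poly_eq_0_iff_dvd)
  have q0: "q \<noteq> 0" using q Suc(3) by auto
  have deg: "degree p = Suc (degree q)" using q0 unfolding q by (subst degree_mult_eq) auto
  have "size (proots q) = degree q"
  proof (rule Suc(1))
    fix z assume "poly (map_poly complex_of_real q) z = 0"
    then show "z \<in> \<real>" using Suc(4)[of z] unfolding q by (simp only: H.hom_mult poly_mult mult_zero_right)
  qed (use deg Suc(2) q0 in auto)
  moreover have "proots p = {#a#} + proots q" using q0 unfolding q by (subst proots_mult) auto
  ultimately show ?case using deg by simp
qed

lemma size_eigenvalues_of_symmetric:
  assumes A: "A \<in> carrier_mat n n" and "transpose_mat A = A"
  shows "size (eigenvalues_of A) = n"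
proof -
  have "degree (char_poly A) = n" "char_poly A \<noteq> 0" using degree_monic_char_poly[OF A] by auto
  then show ?thesis
    using size_proots_real_if_complex_roots_real symmetric_complex_root_real[OF assms]
    by (metis eigenvalues_of_def)
qed

text \<open>The factor of \<open>p\<close> belonging to the root c - x turns into the negative of X
  - x under the substitution, and the cofactor stays nonzero at \<open>x\<close>. Hence
  multiplicities are preserved.\<close>

lemma proots_pcompose_linear:
  fixes p :: "'a :: field poly"
  assumes "p \<noteq> 0"
  shows "proots (p \<circ>\<^sub>p [:c, - 1:]) = image_mset (\<lambda>x. c - x) (proots p)"
proof (rule multiset_eqI)
  fix x
  let ?f = "[:c, - 1:]" and ?a = "c - x"
  have vim: "(-) c -` {x} = {?a}" by auto
  obtain q where q: "p = [:- ?a, 1:] ^ order ?a p * q" and nd: "\<not> [:- ?a, 1:] dvd q"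
    using order_decomp[OF assms] by blast
  have lin: "[:- ?a, 1:] \<circ>\<^sub>p ?f = - [:- x, 1:]" by (simp add: pcompose_pCons)
  have "poly (q \<circ>\<^sub>p ?f) x \<noteq> 0"
    using nd by (simp add: poly_pcompose poly_eq_0_iff_dvd)
  then have nz: "q \<circ>\<^sub>p ?f \<noteq> 0" and ord0: "order x (q \<circ>\<^sub>p ?f) = 0"
    by (auto simp: order_0I)
  have "p \<circ>\<^sub>p ?f = (- [:- x, 1:]) ^ order ?a p * (q \<circ>\<^sub>p ?f)"
    by (subst q) (simp only: pcompose_mult pcompose_hom.hom_power lin)
  also have "\<dots> = Polynomial.smult ((- 1) ^ order ?a p) ([:- x, 1:] ^ order ?a p * (q \<circ>\<^sub>p ?f))"
    by (subst power_minus) (simp add: minus_one_power_iff)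
  finally have "order x (p \<circ>\<^sub>p ?f) = order x ([:- x, 1:] ^ order ?a p * (q \<circ>\<^sub>p ?f))"
    by (simp add: order_smult)
  also have "\<dots> = order ?a p"
    using nz ord0 by (subst order_mult) (auto simp: order_power_n_n)
  finally have ord: "order x (p \<circ>\<^sub>p ?f) = order ?a p" .
  have "p \<circ>\<^sub>p ?f \<noteq> 0" using assms by (simp add: pcompose_eq_0_iff)
  then show "count (proots (p \<circ>\<^sub>p ?f)) x = count (image_mset (\<lambda>x. c - x) (proots p)) x"
    using ord assms by (simp add: count_image_mset vim Int_insert_left order_root)
qed

subsection \<open>Balance and potentials\<close>

text \<open>Unlike the lists in \<open>is_cycle\<close>, walks may repeat vertices and edges, so
  they can be joined, cut and reversed freely. A single vertex is a walk of sign 1.\<close>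

fun walk :: "'a sgraph \<Rightarrow> 'a list \<Rightarrow> bool" where
  "walk S [] \<longleftrightarrow> False"
| "walk S [x] \<longleftrightarrow> True"
| "walk S (x # y # xs) \<longleftrightarrow> {x, y} \<in> edges S \<and> walk S (y # xs)"

fun walk_sign :: "'a sgraph \<Rightarrow> 'a list \<Rightarrow> real" where
  "walk_sign S (x # y # xs) = sgn_of S {x, y} * walk_sign S (y # xs)"
| "walk_sign S _ = 1"

text \<open>The vertex \<open>a\<close> is kept in both halves, so that every edge lies in exactly
  one of them.\<close>

lemma walk_append:
  "walk S (xs @ a # ys) \<longleftrightarrow> walk S (xs @ [a]) \<and> walk S (a # ys)"
  by (induction S xs rule: walk.induct) auto

lemma walk_sign_append:
  "walk_sign S (xs @ a # ys) = walk_sign S (xs @ [a]) * walk_sign S (a # ys)"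
  by (induction S xs rule: walk.induct) auto

lemma walk_rev: "walk S (rev w) \<longleftrightarrow> walk S w"
proof (induction S w rule: walk.induct)
  case (3 S x y xs)
  then show ?case using walk_append[of S "rev xs" y "[x]"] by (auto simp: insert_commute)
qed auto

lemma walk_sign_rev: "walk_sign S (rev w) = walk_sign S w"
proof (induction S w rule: walk_sign.induct)
  case (1 S x y xs)
  then show ?case using walk_sign_append[of S "rev xs" y "[x]"] by (auto simp: insert_commute)
qed auto

lemma walk_sign_unit:
  assumes "signed_graph S" "walk S w"
  shows "walk_sign S w \<in> {1, -1}"
  using assms
proof (induction S w rule: walk.induct)
  case (3 S x y xs)
  then have "sgn_of S {x, y} \<in> {1, -1}" by (simp add: signed_graph_def)
  then show ?case using 3 by auto
qed auto

lemma walk_iff_nth: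
  "walk S w \<longleftrightarrow> w \<noteq> [] \<and> (\<forall>i<length w - 1. {w ! i, w ! Suc i} \<in> edges S)"
proof (induction S w rule: walk.induct)
  case (3 S x y xs)
  then show ?case by (auto simp: nth_Cons less_Suc_eq_0_disj split: nat.splits)
qed auto

lemma walk_sign_prod:
  "walk_sign S w = (\<Prod>i<length w - 1. sgn_of S {w ! i, w ! Suc i})"
proof (induction S w rule: walk_sign.induct)
  case (1 S x y xs)
  have "(\<Prod>i<length (x # y # xs) - 1. sgn_of S {(x # y # xs) ! i, (x # y # xs) ! Suc i})
     = (\<Prod>i<Suc (length xs). sgn_of S {(x # y # xs) ! i, (x # y # xs) ! Suc i})" by simp
  also have "\<dots> = sgn_of S {x, y} * (\<Prod>i<length xs. sgn_of S {(y # xs) ! i, (y # xs) ! Suc i})"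
    by (subst prod.lessThan_Suc_shift) simp
  finally show ?case using 1 by simp
qed auto

lemma closed_walk_sign_cycle:
  assumes "balanced S" "walk S (c @ [hd c])" "distinct c" "3 \<le> length c"
  shows "walk_sign S (c @ [hd c]) = 1"
proof -
  \<comment> \<open>Appending \<open>hd c\<close> unrolls the cyclic list: the last edge of the walk
    is the wrap-around edge that \<open>cycle_edge\<close> obtains from the index modulo the
    length.\<close>
  have e: "{(c @ [hd c]) ! i, (c @ [hd c]) ! Suc i} = cycle_edge c i" if "i < length c" for i
  proof (cases "Suc i = length c")
    case True
    moreover from this have "(c @ [hd c]) ! Suc i = c ! 0"
      using that by (cases c) (auto simp: nth_append)
    ultimately show ?thesis using that by (simp add: cycle_edge_def nth_append)
  next
    case False
    then show ?thesis using that by (simp add: cycle_edge_def nth_append)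
  qed
  have "is_cycle S c" using assms e by (auto simp: is_cycle_def walk_iff_nth)
  moreover have "walk_sign S (c @ [hd c]) = cycle_sign S c"
    unfolding walk_sign_prod cycle_sign_def using e by (intro prod.cong) auto
  ultimately show ?thesis using assms(1) by (simp add: balanced_def)
qed

text \<open>Strong induction on the length. A vertex repeated before the end allows a shorter closed
  walk to be cut out, and the two pieces have signs whose product is that of the whole. Without
  repetition the walk is a cycle or has fewer than three edges.\<close>

lemma closed_walk_sign:
  assumes "signed_graph S" "balanced S" "walk S w" "hd w = last w"
  shows "walk_sign S w = 1"
  using assms(3,4)
proof (induction "length w" arbitrary: w rule: less_induct)
  case less
  then have "w \<noteq> []" by auto
  then obtain c a where w: "w = c @ [a]" by (cases w rule: rev_cases) auto
  have noloop: "{x} \<notin> edges S" for x using assms(1) by (auto simp: signed_graph_def)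
  show ?case
  proof (cases "distinct c")
    case True
    show ?thesis
    proof (cases "3 \<le> length c")
      case True
      then have "a = hd c" using less(3) w by (cases c) auto
      then show ?thesis using closed_walk_sign_cycle assms(2) \<open>distinct c\<close> True less(2) w by blast
    next
      case False
      \<comment> \<open>The three cases are the trivial walk, a loop, which is impossible, and one
        edge traversed back and forth, whose sign is squared.\<close>
      then consider "c = []" | x where "c = [x]" | x y where "c = [x, y]"
        by (cases c; cases "tl c"; cases "tl (tl c)") auto
      then show ?thesis
      proof cases
        case 3
        then have "{a, y} \<in> edges S" using less(2,3) w by auto
        then have "sgn_of S {a, y} \<in> {1, -1}" using assms(1) by (auto simp: signed_graph_def)
        then show ?thesis using 3 less(2,3) w by (auto simp: insert_commute)
      qed (use less(2,3) w noloop in auto)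
    qed
  next
    case False
    then obtain us b vs ws where c: "c = us @ [b] @ vs @ [b] @ ws"
      using not_distinct_decomp by blast
    let ?i = "b # vs @ [b]" and ?o = "us @ b # ws @ [a]"
    \<comment> \<open>The inner walk \<open>?i\<close> runs between the two occurrences of
      \<open>b\<close>; the outer walk \<open>?o\<close> bypasses it. Both are closed and shorter
      than \<open>w\<close>.\<close>
    have w': "w = us @ b # vs @ b # ws @ [a]" using w c by simp
    have wlk: "walk S (us @ [b])" "walk S ?i" "walk S (b # ws @ [a])"
      using less(2) walk_append[of S us b "vs @ b # ws @ [a]"]
        walk_append[of S "b # vs" b "ws @ [a]"] by (simp_all add: w')
    have "walk_sign S w = walk_sign S (us @ [b]) * (walk_sign S ?i * walk_sign S (b # ws @ [a]))"
      using walk_sign_append[of S us b "vs @ b # ws @ [a]"]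
        walk_sign_append[of S "b # vs" b "ws @ [a]"] by (simp add: w')
    also have "walk_sign S ?i = 1"
      by (rule less(1)) (use w' wlk in auto)
    also have "walk_sign S (us @ [b]) * (1 * walk_sign S (b # ws @ [a])) = walk_sign S ?o"
      using walk_sign_append[of S us b "ws @ [a]"] by simp
    also have "\<dots> = 1"
    proof (rule less(1))
      show "walk S ?o" using wlk walk_append[of S us b "ws @ [a]"] by simp
      show "hd ?o = last ?o" using less(3) w' by (cases us) auto
    qed (use w' in auto)
    finally show ?thesis .
  qed
qed

section \<open>Connected components and the potential of a balanced graph\<close>

definition reach :: "'a sgraph \<Rightarrow> ('a \<times> 'a) set" where
  "reach S = {(x, y). {x, y} \<in> edges S}\<^sup>*"

lemma sym_reach: "sym (reach S)"
  unfolding reach_def by (intro sym_rtrancl) (auto simp: sym_def insert_commute)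

lemma reach_imp_walk:
  assumes "(x, y) \<in> reach S"
  shows "\<exists>w. walk S w \<and> hd w = x \<and> last w = y"
  using assms unfolding reach_def
proof (induction rule: converse_rtrancl_induct)
  case base
  then show ?case by (intro exI[of _ "[y]"]) auto
next
  case (step u v)
  then obtain w where w: "walk S w" "hd w = v" "last w = y" by blast
  then show ?case using step(1) by (intro exI[of _ "u # w"], cases w) auto
qed

text \<open>Harary's criterion: switch every vertex by the sign of a walk from a root of its component.\<close>

lemma balanced_potential:
  assumes "signed_graph S" "balanced S"
  obtains s :: "'a \<Rightarrow> real" where "\<And>v. s v \<in> {1, -1}"
    and "\<And>u v. {u, v} \<in> edges S \<Longrightarrow> s u * s v = sgn_of S {u, v}"
proof -
  define rep where "rep v = (SOME r. (r, v) \<in> reach S)" for v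
  define W where "W v = (SOME w. walk S w \<and> hd w = rep v \<and> last w = v)" for v
  have "(rep v, v) \<in> reach S" for v
    unfolding rep_def by (rule someI[of _ v]) (simp add: reach_def)
  then have W: "walk S (W v) \<and> hd (W v) = rep v \<and> last (W v) = v" for v
    unfolding W_def by (rule someI_ex[OF reach_imp_walk])
  have edge: "walk_sign S (W u) * walk_sign S (W v) = sgn_of S {u, v}" if uv: "{u, v} \<in> edges S" for u v
  proof -
    have "(u, v) \<in> reach S" "(v, u) \<in> reach S"
      using uv by (auto simp: reach_def insert_commute)
    then have "(r, u) \<in> reach S \<longleftrightarrow> (r, v) \<in> reach S" for r
      unfolding reach_def by (meson rtrancl_trans)
    \<comment> \<open>The choice of \<open>rep\<close> depends only on the set of vertices from
      which the given vertex is reachable, and this set is the same for \<open>u\<close> and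
      \<open>v\<close>.\<close>
    then have rep: "rep u = rep v" by (simp add: rep_def)
    obtain us where us: "W u = us @ [u]" using W[of u] by (cases "W u" rule: rev_cases) auto
    obtain vs where vs: "W v = vs @ [v]" using W[of v] by (cases "W v" rule: rev_cases) auto
    \<comment> \<open>Out from the common root to \<open>u\<close>, across the edge, and back from
      \<open>v\<close> to the root: a closed walk, hence of sign 1.\<close>
    let ?w = "us @ u # v # rev vs"
    have split: "walk S ?w \<longleftrightarrow> walk S (us @ [u]) \<and> {u, v} \<in> edges S \<and> walk S (vs @ [v])"
      using walk_append[of S us u "v # rev vs"] walk_rev[of S "vs @ [v]"] by simp
    have "hd ?w = rep u" using W[of u] us by (cases us) auto
    moreover have "last ?w = rep v" using W[of v] vs by (cases vs) auto
    ultimately have "walk_sign S ?w = 1"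
      using closed_walk_sign[OF assms] split W[of u] W[of v] us vs uv rep by metis
    moreover have "walk_sign S ?w = walk_sign S (W u) * (sgn_of S {u, v} * walk_sign S (W v))"
      using walk_sign_append[of S us u "v # rev vs"] walk_sign_rev[of S "vs @ [v]"] us vs by simp
    moreover have "sgn_of S {u, v} \<in> {1, -1}" using uv assms(1) by (auto simp: signed_graph_def)
    ultimately show ?thesis by auto
  qed
  show ?thesis
    using that[of "\<lambda>v. walk_sign S (W v)"] walk_sign_unit[OF assms(1)] W edge by blast
qed

lemma component_class:
  assumes "C \<in> components S"
  obtains r where "r \<in> C" "C = {v \<in> verts S. (r, v) \<in> reach S}"
proof -
  obtain r where r: "r \<in> verts S" "C = {v \<in> verts S. (r, v) \<in> reach S}"
    using assms unfolding components_def reach_def[symmetric] by (auto simp: quotient_def)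
  moreover have "r \<in> C" using r by (simp add: reach_def)
  ultimately show ?thesis using that by blast
qed

lemma component_of_vertex:
  assumes "v \<in> verts S"
  obtains C where "C \<in> components S" "v \<in> C"
proof
  show "{u \<in> verts S. (v, u) \<in> reach S} \<in> components S"
    using assms unfolding components_def reach_def[symmetric] by (auto simp: quotient_def)
  show "v \<in> {u \<in> verts S. (v, u) \<in> reach S}" using assms by (simp add: reach_def)
qed

lemma component_eq:
  assumes "C \<in> components S" "D \<in> components S" "v \<in> C" "v \<in> D"
  shows "C = D"
proof -
  have "E = {u \<in> verts S. (v, u) \<in> reach S}" if E: "E \<in> components S" "v \<in> E" for E
  proof -
    obtain r where r: "E = {v \<in> verts S. (r, v) \<in> reach S}" using component_class[OF E(1)] by metis
    then have rv: "(r, v) \<in> reach S" using E(2) by blast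
    then have vr: "(v, r) \<in> reach S" using sym_reach by (metis symD)
    have "(r, u) \<in> reach S \<longleftrightarrow> (v, u) \<in> reach S" for u
      using rv vr unfolding reach_def by (meson rtrancl_trans)
    then show ?thesis using r by simp
  qed
  from this[OF assms(1,3)] this[OF assms(2,4)] show ?thesis by simp
qed

lemma edge_in_component:
  assumes "signed_graph S" "C \<in> components S" "{u, v} \<in> edges S"
  shows "u \<in> C \<longleftrightarrow> v \<in> C"
proof -
  have "(u, v) \<in> reach S" "(v, u) \<in> reach S" "u \<in> verts S" "v \<in> verts S"
    using assms by (auto simp: reach_def insert_commute signed_graph_def)
  moreover obtain r where "C = {v \<in> verts S. (r, v) \<in> reach S}"
    using component_class[OF assms(2)] by metis
  ultimately show ?thesis unfolding reach_def by (auto intro: rtrancl_trans)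
qed

text \<open>Agreement across each edge propagates along paths from a root. It is applied to the
  absolute value of a kernel vector and to the product of such a vector with a potential.\<close>

lemma component_constant:
  assumes "signed_graph S" "C \<in> components S"
    and inv: "\<And>u v. {u, v} \<in> edges S \<Longrightarrow> u \<in> C \<Longrightarrow> v \<in> C \<Longrightarrow> f u = f v"
    and "x \<in> C" "y \<in> C"
  shows "f x = f y"
proof -
  obtain r where r: "r \<in> C" "C = {v \<in> verts S. (r, v) \<in> reach S}"
    using component_class[OF assms(2)] by blast
  have "v \<in> C \<and> f r = f v" if "(r, v) \<in> reach S" for v
    using that unfolding reach_def
  proof (induction rule: rtrancl_induct)
    case (step u v)
    then show ?case using inv[of u v] edge_in_component[OF assms(1,2), of u v] by auto
  qed (use r in simp)
  then show ?thesis using assms(4,5) r(2) by (metis (mono_tags, lifting) mem_Collect_eq)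
qed

lemma signed_graph_induced:
  assumes "signed_graph S" "C \<in> components S"
  shows "signed_graph (induced S C)"
proof -
  have "C \<subseteq> verts S" using component_class[OF assms(2)] by blast
  then show ?thesis using assms(1) by (auto simp: signed_graph_def induced_def intro: finite_subset)
qed

text \<open>The absolute value of \<open>x\<close> is constant on \<open>C\<close>, so
  \<open>x\<close> vanishes nowhere there. Multiplying the edge relation around a cycle puts the
  same nonzero product on both sides, with the cycle sign as the factor between them.\<close>

lemma balanced_if_nonzero:
  assumes "signed_graph S" "C \<in> components S"
    and x: "\<And>u v. {u, v} \<in> edges S \<Longrightarrow> x u = sgn_of S {u, v} * x v"
    and "w \<in> C" "x w \<noteq> (0::real)"
  shows "balanced (induced S C)"
  unfolding balanced_def
proof (intro allI impI)
  fix c assume c: "is_cycle (induced S C) c"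
  let ?n = "length c"
  have "\<bar>x u\<bar> = \<bar>x v\<bar>" if "{u, v} \<in> edges S" for u v
    using x[OF that] that assms(1) by (auto simp: signed_graph_def abs_mult)
  then have nz: "x v \<noteq> 0" if "v \<in> C" for v
    using component_constant[OF assms(1,2), of "\<lambda>v. \<bar>x v\<bar>" v w] that assms(4,5) by auto
  have n: "0 < ?n" using c by (auto simp: is_cycle_def)
  have e: "cycle_edge c i \<in> edges S" "cycle_edge c i \<subseteq> C" if "i < ?n" for i
    using c that by (auto simp: is_cycle_def induced_def)
  have "x (c ! i) = sgn_of S (cycle_edge c i) * x (c ! (Suc i mod ?n))" if "i < ?n" for i
    using x e(1)[OF that] by (simp add: cycle_edge_def)
  then have "(\<Prod>i<?n. x (c ! i)) = cycle_sign S c * (\<Prod>i<?n. x (c ! (Suc i mod ?n)))"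
    unfolding cycle_sign_def prod.distrib[symmetric] by (intro prod.cong) auto
  \<comment> \<open>The cyclic shift of indices merely permutes the factors; the last factor wraps
    around to index 0.\<close>
  also have "(\<Prod>i<?n. x (c ! (Suc i mod ?n))) = (\<Prod>i<?n. x (c ! i))"
  proof -
    obtain k where k: "?n = Suc k" using n by (cases ?n) auto
    have "(\<Prod>i<k. x (c ! (Suc i mod ?n))) = (\<Prod>i<k. x (c ! Suc i))"
      by (intro prod.cong) (auto simp: k)
    then have "(\<Prod>i<?n. x (c ! (Suc i mod ?n))) = (\<Prod>i<k. x (c ! Suc i)) * x (c ! 0)"
      by (simp add: k)
    then show ?thesis unfolding k prod.lessThan_Suc_shift by (simp add: k)
  qed
  finally have "(\<Prod>i<?n. x (c ! i)) = cycle_sign S c * (\<Prod>i<?n. x (c ! i))" .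
  moreover have "(\<Prod>i<?n. x (c ! i)) \<noteq> 0"
    using nz e(2) by (auto simp: cycle_edge_def)
  ultimately have "cycle_sign S c = 1" by simp
  then show "cycle_sign (induced S C) c = 1" by (simp add: cycle_sign_def induced_def)
qed

subsection \<open>The multiplicity of the eigenvalue zero\<close>

lemma poly_char_poly_0_iff:
  fixes A :: "'a :: field mat"
  assumes A: "A \<in> carrier_mat n n"
  shows "poly (char_poly A) 0 = 0 \<longleftrightarrow> (\<exists>v \<in> carrier_vec n. v \<noteq> 0\<^sub>v n \<and> A *\<^sub>v v = 0\<^sub>v n)"
proof -
  have "poly (char_poly A) 0 = 0 \<longleftrightarrow> eigenvalue A 0"
    using eigenvalue_root_char_poly[OF A] by simp
  also have "\<dots> \<longleftrightarrow> (\<exists>v \<in> carrier_vec n. v \<noteq> 0\<^sub>v n \<and> A *\<^sub>v v = 0\<^sub>v n)"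
  proof -
    have "0 \<cdot>\<^sub>v v = 0\<^sub>v n" if "v \<in> carrier_vec n" for v :: "'a vec"
      using that by (intro eq_vecI) auto
    then show ?thesis using A by (auto simp: eigenvalue_def eigenvector_def)
  qed
  finally show ?thesis .
qed

lemma gram_scalar_prod:
  fixes H :: "'a :: comm_ring_1 mat"
  assumes H: "H \<in> carrier_mat n m" and v: "v \<in> carrier_vec n"
  shows "v \<bullet> ((H * transpose_mat H) *\<^sub>v v) = (transpose_mat H *\<^sub>v v) \<bullet> (transpose_mat H *\<^sub>v v)"
proof -
  have Hv: "transpose_mat H *\<^sub>v v \<in> carrier_vec m" using H v by simp
  have "(H * transpose_mat H) *\<^sub>v v = H *\<^sub>v (transpose_mat H *\<^sub>v v)"
    using H v by (intro assoc_mult_mat_vec[of _ n m _ n]) auto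
  then show ?thesis using transpose_vec_mult_scalar[OF H Hv v] by simp
qed

lemma scalar_prod_self_nonneg: "(v :: real vec) \<bullet> v \<ge> 0"
  by (simp add: scalar_prod_def sum_nonneg)

lemma scalar_prod_self_eq_0:
  assumes "(v :: real vec) \<in> carrier_vec n" "v \<bullet> v = 0"
  shows "v = 0\<^sub>v n"
  using conjugate_square_eq_0_vec[OF assms(1)] assms(2) by simp

text \<open>For an eigenvector \<open>v\<close>, the number \<open>l * (v \<bullet> v)\<close> is
  the squared length of H^T v.\<close>

lemma gram_root_nonneg:
  fixes H :: "real mat"
  assumes H: "H \<in> carrier_mat n m" and root: "poly (char_poly (H * transpose_mat H)) l = 0"
  shows "l \<ge> 0"
proof -
  have HH: "H * transpose_mat H \<in> carrier_mat n n" using H by simp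
  obtain v where v: "v \<in> carrier_vec n" "v \<noteq> 0\<^sub>v n" "(H * transpose_mat H) *\<^sub>v v = l \<cdot>\<^sub>v v"
    using root H unfolding eigenvalue_root_char_poly[OF HH, symmetric]
    by (auto simp: eigenvalue_def eigenvector_def)
  have "l * (v \<bullet> v) = v \<bullet> ((H * transpose_mat H) *\<^sub>v v)" using v by simp
  also have "\<dots> \<ge> 0" unfolding gram_scalar_prod[OF H v(1)] by (rule scalar_prod_self_nonneg)
  finally have "l * (v \<bullet> v) \<ge> 0" .
  moreover have "v \<bullet> v > 0"
    using v scalar_prod_self_nonneg[of v] scalar_prod_self_eq_0[of v n] by force
  ultimately show ?thesis by (simp add: zero_le_mult_iff)
qed

lemma replicate_mset_plus: "replicate_mset (i + j) x = replicate_mset i x + replicate_mset j x"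
  by (rule multiset_eqI) simp

lemma proots_monom: "proots (monom 1 k :: 'a :: idom poly) = replicate_mset k 0"
  by (rule multiset_eqI) (simp add: monom_altdef proots_power del: count_proots)

text \<open>The columns of \<open>B\<close> form an orthogonal basis of the kernel of \<open>H\<^sup>T\<close>. Adding \<open>B B\<^sup>T\<close> to
  \<open>H H\<^sup>T\<close> removes the eigenvalue \<open>0\<close>, and since the two matrices annihilate each other, their
  characteristic polynomials multiply to \<open>x\<^sup>n\<close> times that of the sum.\<close>

lemma count_0_eigenvalues_gram:
  fixes H B :: "real mat"
  assumes H: "H \<in> carrier_mat n m" and B: "B \<in> carrier_mat n b"
    and HB: "transpose_mat H * B = 0\<^sub>m m b"
    and diag: "\<And>i j. i < b \<Longrightarrow> j < b \<Longrightarrow> (transpose_mat B * B) $$ (i, j) \<noteq> 0 \<longleftrightarrow> i = j"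
    and ker: "\<And>x. x \<in> carrier_vec n \<Longrightarrow> transpose_mat H *\<^sub>v x = 0\<^sub>v m \<Longrightarrow>
      transpose_mat B *\<^sub>v x = 0\<^sub>v b \<Longrightarrow> x = 0\<^sub>v n"
  shows "count (eigenvalues_of (H * transpose_mat H)) 0 = b"
proof -
  let ?L = "H * transpose_mat H" and ?P = "B * transpose_mat B" and ?D = "transpose_mat B * B"
  have L: "?L \<in> carrier_mat n n" and P: "?P \<in> carrier_mat n n" and D: "?D \<in> carrier_mat b b"
    using H B by auto
  have LP: "?L + ?P \<in> carrier_mat n n" using L P by simp
  have nz: "char_poly A \<noteq> 0" if "A \<in> carrier_mat k k" for A :: "real mat" and k
    using degree_monic_char_poly[OF that] by auto
  have "?L * ?P = H * ((transpose_mat H * B) * transpose_mat B)"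
    using H B by (simp add: assoc_mult_mat[of _ n m _ n _ n] assoc_mult_mat[of _ m n _ b _ n])
  also have "\<dots> = 0\<^sub>m n n" unfolding HB using H B by simp
  finally have "char_poly ?L * char_poly ?P = monom 1 n * char_poly (?L + ?P)"
    by (rule char_poly_add_orthogonal[OF L P])
  then have 1: "proots (char_poly ?L) + proots (char_poly ?P)
      = replicate_mset n 0 + proots (char_poly (?L + ?P))"
    using nz[OF L] nz[OF P] nz[OF LP] by (metis proots_mult proots_monom monom_eq_0_iff one_neq_zero)
  have "monom 1 b * char_poly ?P = monom 1 n * char_poly ?D"
    using B by (intro char_poly_mult_commute) auto
  then have 2: "replicate_mset b 0 + proots (char_poly ?P) = replicate_mset n 0 + proots (char_poly ?D)"
    using nz[OF P] nz[OF D] by (metis proots_mult proots_monom monom_eq_0_iff one_neq_zero)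
  \<comment> \<open>The quadratic form of the sum is |H^T v|^2 + |B^T v|^2, so a vector in its
    kernel is killed by both transposes and is zero by \<open>ker\<close>.\<close>
  have "poly (char_poly (?L + ?P)) 0 \<noteq> 0"
  proof
    assume "poly (char_poly (?L + ?P)) 0 = 0"
    then obtain v where v: "v \<in> carrier_vec n" "v \<noteq> 0\<^sub>v n" "(?L + ?P) *\<^sub>v v = 0\<^sub>v n"
      unfolding poly_char_poly_0_iff[OF LP] by blast
    have Hv: "transpose_mat H *\<^sub>v v \<in> carrier_vec m" and Bv: "transpose_mat B *\<^sub>v v \<in> carrier_vec b"
      using H B v by auto
    have "0 = v \<bullet> ((?L + ?P) *\<^sub>v v)" using v by simp
    also have "\<dots> = v \<bullet> (?L *\<^sub>v v) + v \<bullet> (?P *\<^sub>v v)"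
      unfolding add_mult_distrib_mat_vec[OF L P v(1)]
      using v(1) mult_mat_vec_carrier[OF L v(1)] mult_mat_vec_carrier[OF P v(1)]
      by (rule scalar_prod_add_distrib)
    finally have "(transpose_mat H *\<^sub>v v) \<bullet> (transpose_mat H *\<^sub>v v)
        + (transpose_mat B *\<^sub>v v) \<bullet> (transpose_mat B *\<^sub>v v) = 0"
      unfolding gram_scalar_prod[OF H v(1)] gram_scalar_prod[OF B v(1)] by simp
    then have "transpose_mat H *\<^sub>v v = 0\<^sub>v m" "transpose_mat B *\<^sub>v v = 0\<^sub>v b"
      using scalar_prod_self_nonneg[of "transpose_mat H *\<^sub>v v"]
        scalar_prod_self_nonneg[of "transpose_mat B *\<^sub>v v"]
        scalar_prod_self_eq_0[OF Hv] scalar_prod_self_eq_0[OF Bv] by linarith+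
    then show False using ker v by blast
  qed
  then have Z: "count (proots (char_poly (?L + ?P))) 0 = 0" using nz[OF LP] by (simp add: order_0I)
  \<comment> \<open>The Gram matrix \<open>?D\<close> is diagonal with nonzero diagonal entries, so
    it has no eigenvalue 0.\<close>
  have "poly (char_poly M) 0 \<noteq> 0"
    if M: "M \<in> carrier_mat b b" "\<And>i j. i < b \<Longrightarrow> j < b \<Longrightarrow> M $$ (i, j) \<noteq> 0 \<longleftrightarrow> i = j" for M :: "real mat"
  proof -
    have "M $$ (i, j) = 0" if "i < b" "j < i" for i j using M(2)[of i j] that by simp
    moreover have nonzero: "M $$ (i, i) \<noteq> 0" if "i < b" for i using M(2)[of i i] that by simp
    ultimately have "upper_triangular M" using M(1) by (auto simp: upper_triangular_def)
    from char_poly_upper_triangular[OF M(1) this] show ?thesis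
      using M(1) nonzero by (auto simp: poly_prod_list prod_list_zero_iff diag_mat_def)
  qed
  from this[OF D diag] have W: "count (proots (char_poly ?D)) 0 = 0"
    using nz[OF D] by (simp add: order_0I)
  \<comment> \<open>The multiplicity of 0 in \<open>?P\<close> serves as the link: together with
    that in \<open>?L\<close> it makes n, and together with \<open>b\<close> it also makes
    n.\<close>
  have "count (proots (char_poly ?L)) 0 + count (proots (char_poly ?P)) 0 = n"
    using arg_cong[OF 1, of "\<lambda>M. count M 0"] Z unfolding count_union by (simp del: count_proots)
  moreover have "b + count (proots (char_poly ?P)) 0 = n"
    using arg_cong[OF 2, of "\<lambda>M. count M 0"] W unfolding count_union by (simp del: count_proots)
  ultimately show ?thesis unfolding eigenvalues_of_def by linarith
qed

section \<open>The Laplacian as a Gram matrix, and its kernel\<close>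

lemma sum_enumerates:
  assumes "enumerates xs X"
  shows "(\<Sum>i = 0..<length xs. f (xs ! i)) = sum f X"
  using assms bij_betw_nth[of xs "{0..<length xs}" X]
  by (intro sum.reindex_bij_betw) (auto simp: enumerates_def atLeast0LessThan)

lemma finite_edges: "signed_graph S \<Longrightarrow> finite (edges S)"
  by (rule finite_subset[of _ "Pow (verts S)"]) (auto simp: signed_graph_def)

text \<open>On the diagonal every edge at the vertex contributes a square equal to 1, which gives
  the degree. Off the diagonal at most one edge contains both vertices, and its contribution is
  minus its sign.\<close>

lemma laplacian_mat_gram:
  assumes S: "signed_graph S" and \<eta>: "is_incidence S \<eta>"
    and vs: "enumerates vs (verts S)" and es: "enumerates es (edges S)"
  shows "laplacian_mat S vs = incidence_mat \<eta> vs es * transpose_mat (incidence_mat \<eta> vs es)"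
    (is "?L = ?R")
proof (rule eq_matI)
  fix i j assume "i < dim_row ?R" "j < dim_col ?R"
  then have i: "i < length vs" and j: "j < length vs" by (auto simp: incidence_mat_def)
  let ?u = "vs ! i" and ?v = "vs ! j"
  have uV: "?u \<in> verts S" and vV: "?v \<in> verts S" using i j vs nth_mem by (auto simp: enumerates_def)
  have R: "?R $$ (i, j) = (\<Sum>e\<in>edges S. \<eta> ?u e * \<eta> ?v e)"
    using i j sum_enumerates[OF es, of "\<lambda>e. \<eta> ?u e * \<eta> ?v e"]
    by (simp add: incidence_mat_def scalar_prod_def)
  show "?L $$ (i, j) = ?R $$ (i, j)"
  proof (cases "i = j")
    case True
    have "(\<Sum>e\<in>edges S. \<eta> ?u e * \<eta> ?u e) = (\<Sum>e\<in>edges S. if ?u \<in> e then 1 else 0)"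
      using \<eta> uV by (intro sum.cong) (force simp: is_incidence_def)+
    also have "\<dots> = real (card {e \<in> edges S. ?u \<in> e})"
      using finite_edges[OF S] by (simp add: sum.If_cases Int_def)
    moreover have "{?u} \<notin> edges S" using S by (auto simp: signed_graph_def)
    ultimately show ?thesis using R True i
      by (simp add: laplacian_mat_def degree_mat_def adjacency_mat_def)
  next
    case False
    then have uv: "?u \<noteq> ?v" using i j vs by (simp add: enumerates_def nth_eq_iff_index_eq)
    have eq: "e = {?u, ?v}" if "e \<in> edges S" "?u \<in> e" "?v \<in> e" for e
      using S that uv by (auto simp: signed_graph_def card_2_iff doubleton_eq_iff)
    have "(\<Sum>e\<in>edges S. \<eta> ?u e * \<eta> ?v e) = (\<Sum>e\<in>edges S \<inter> {{?u, ?v}}. \<eta> ?u e * \<eta> ?v e)"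
      using finite_edges[OF S] \<eta> uV vV eq
      by (intro sum.mono_neutral_right) (auto simp: is_incidence_def)
    also have "\<dots> = (if {?u, ?v} \<in> edges S then - sgn_of S {?u, ?v} else 0)"
      using \<eta> by (auto simp: is_incidence_def Int_insert_right)
    finally show ?thesis using R False i j
      by (simp add: laplacian_mat_def degree_mat_def adjacency_mat_def)
  qed
qed (auto simp: laplacian_mat_def degree_mat_def adjacency_mat_def incidence_mat_def)

text \<open>Only the two endpoints contribute to the entry of H^T x at this edge, and their
  incidence entries multiply to minus the sign.\<close>

lemma incidence_sum_eq_0_iff:
  assumes S: "signed_graph S" and \<eta>: "is_incidence S \<eta>" and e: "{u, v} \<in> edges S"
  shows "(\<Sum>w\<in>verts S. \<eta> w {u, v} * x w) = 0 \<longleftrightarrow> x u = sgn_of S {u, v} * x v"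
proof -
  have uv: "u \<noteq> v" "u \<in> verts S" "v \<in> verts S" "finite (verts S)"
    using S e by (auto simp: signed_graph_def)
  have "(\<Sum>w\<in>verts S. \<eta> w {u, v} * x w) = (\<Sum>w\<in>{u, v}. \<eta> w {u, v} * x w)"
    using uv \<eta> e by (intro sum.mono_neutral_right) (auto simp: is_incidence_def)
  also have "\<dots> = \<eta> u {u, v} * x u + \<eta> v {u, v} * x v" using uv by simp
  moreover have "\<eta> u {u, v} \<in> {1, -1}" "\<eta> v {u, v} \<in> {1, -1}"
    using \<eta> e uv by (auto simp: is_incidence_def)
  moreover have "sgn_of S {u, v} = - (\<eta> u {u, v} * \<eta> v {u, v})"
    using \<eta> e by (simp add: is_incidence_def)
  ultimately show ?thesis by auto
qed

text \<open>The potential of the induced graph is extended by zero. No edge leaves \<open>C\<close>,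
  so the edge relation then holds throughout the graph.\<close>

lemma balanced_component_potential:
  assumes S: "signed_graph S" and C: "C \<in> components S" and bal: "balanced (induced S C)"
  shows "\<exists>s :: 'a \<Rightarrow> real. (\<forall>v. v \<notin> C \<longrightarrow> s v = 0) \<and> (\<forall>v\<in>C. s v \<in> {1, -1})
    \<and> (\<forall>u v. {u, v} \<in> edges S \<longrightarrow> s u = sgn_of S {u, v} * s v)"
proof -
  obtain s :: "'a \<Rightarrow> real" where s: "\<And>v. s v \<in> {1, -1}"
    and e: "\<And>u v. {u, v} \<in> edges (induced S C) \<Longrightarrow> s u * s v = sgn_of (induced S C) {u, v}"
    using balanced_potential[OF signed_graph_induced[OF S C] bal] by blast
  have "s u = sgn_of S {u, v} * s v" if "{u, v} \<in> edges S" "u \<in> C" "v \<in> C" for u v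
    using e[of u v] s[of v] that by (auto simp: induced_def)
  then show ?thesis
    using s edge_in_component[OF S C] by (intro exI[of _ "\<lambda>v. if v \<in> C then s v else 0"]) auto
qed

lemma count_0_laplacian:
  assumes S: "signed_graph S" and \<eta>: "is_incidence S \<eta>"
    and vs: "enumerates vs (verts S)" and es: "enumerates es (edges S)"
  shows "count (eigenvalues_of (laplacian_mat S vs)) 0 = num_balanced_components S"
proof -
  let ?BC = "{C \<in> components S. balanced (induced S C)}"
  let ?H = "incidence_mat \<eta> vs es"
  have subV: "C \<subseteq> verts S" if "C \<in> components S" for C using component_class[OF that] by blast
  have finV: "finite (verts S)" using S by (simp add: signed_graph_def)
  have "finite ?BC" by (rule finite_subset[of _ "Pow (verts S)"]) (use subV finV in auto)
  then obtain Cs where Cs: "set Cs = ?BC" "distinct Cs" using finite_distinct_list by blast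
  let ?b = "length Cs" and ?n = "length vs" and ?m = "length es"
  have b: "num_balanced_components S = ?b"
    unfolding num_balanced_components_def using Cs distinct_card by metis
  have CsD: "Cs ! k \<in> components S" "balanced (induced S (Cs ! k))" if "k < ?b" for k
    using nth_mem[OF that] Cs by auto
  have "\<forall>C\<in>?BC. \<exists>s :: 'a \<Rightarrow> real. (\<forall>v. v \<notin> C \<longrightarrow> s v = 0) \<and> (\<forall>v\<in>C. s v \<in> {1, -1})
    \<and> (\<forall>u v. {u, v} \<in> edges S \<longrightarrow> s u = sgn_of S {u, v} * s v)"
    using balanced_component_potential[OF S] by blast
  then obtain s :: "'a set \<Rightarrow> 'a \<Rightarrow> real" where "\<forall>C\<in>?BC. (\<forall>v. v \<notin> C \<longrightarrow> s C v = 0)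
      \<and> (\<forall>v\<in>C. s C v \<in> {1, -1}) \<and> (\<forall>u v. {u, v} \<in> edges S \<longrightarrow> s C u = sgn_of S {u, v} * s C v)"
    unfolding bchoice_iff by blast
  then have s0: "\<And>C v. C \<in> ?BC \<Longrightarrow> v \<notin> C \<Longrightarrow> s C v = 0"
    and s1: "\<And>C v. C \<in> ?BC \<Longrightarrow> v \<in> C \<Longrightarrow> s C v \<in> {1, -1}"
    and se: "\<And>C u v. C \<in> ?BC \<Longrightarrow> {u, v} \<in> edges S \<Longrightarrow> s C u = sgn_of S {u, v} * s C v"
    by blast+
  have BC: "Cs ! k \<in> ?BC" if "k < ?b" for k using nth_mem[OF that] Cs by simp
  \<comment> \<open>One column per balanced component, holding its potential; these columns will
    span the kernel of H^T.\<close>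
  define B where "B = mat ?n ?b (\<lambda>(i, k). s (Cs ! k) (vs ! i))"
  have H: "?H \<in> carrier_mat ?n ?m" and Bc: "B \<in> carrier_mat ?n ?b"
    by (auto simp: incidence_mat_def B_def)
  have edge: "\<exists>u v. es ! k = {u, v} \<and> {u, v} \<in> edges S" if "k < ?m" for k
  proof -
    have "es ! k \<in> edges S" using nth_mem[OF that] es by (simp add: enumerates_def)
    moreover from this obtain u v where "es ! k = {u, v}" using S by (auto simp: signed_graph_def card_2_iff)
    ultimately show ?thesis by auto
  qed
  have "count (eigenvalues_of (?H * transpose_mat ?H)) 0 = ?b"
  proof (rule count_0_eigenvalues_gram[OF H Bc])
    show "transpose_mat ?H * B = 0\<^sub>m ?m ?b"
    proof (rule eq_matI)
      fix k l assume "k < dim_row (0\<^sub>m ?m ?b)" "l < dim_col (0\<^sub>m ?m ?b)"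
      then have k: "k < ?m" and l: "l < ?b" by auto
      have "(transpose_mat ?H * B) $$ (k, l) = (\<Sum>w\<in>verts S. \<eta> w (es ! k) * s (Cs ! l) w)"
        using k l sum_enumerates[OF vs, of "\<lambda>w. \<eta> w (es ! k) * s (Cs ! l) w"]
        by (simp add: incidence_mat_def B_def scalar_prod_def)
      also have "\<dots> = 0"
      proof -
        obtain u v where uv: "es ! k = {u, v}" "{u, v} \<in> edges S" using edge[OF k] by blast
        show ?thesis
          unfolding uv(1) incidence_sum_eq_0_iff[OF S \<eta> uv(2)] by (rule se[OF BC[OF l] uv(2)])
      qed
      finally show "(transpose_mat ?H * B) $$ (k, l) = 0\<^sub>m ?m ?b $$ (k, l)" using k l by simp
    qed (auto simp: incidence_mat_def B_def)
  next
    fix k l assume k: "k < ?b" and l: "l < ?b"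
    have D: "(transpose_mat B * B) $$ (k, l) = (\<Sum>w\<in>verts S. s (Cs ! k) w * s (Cs ! l) w)"
      using k l sum_enumerates[OF vs, of "\<lambda>w. s (Cs ! k) w * s (Cs ! l) w"]
      by (simp add: B_def scalar_prod_def)
    show "(transpose_mat B * B) $$ (k, l) \<noteq> 0 \<longleftrightarrow> k = l"
    proof
      assume "(transpose_mat B * B) $$ (k, l) \<noteq> 0"
      \<comment> \<open>Each potential is supported on its own component, and distinct components
        are disjoint, so distinct columns are orthogonal.\<close>
      then obtain w where "s (Cs ! k) w * s (Cs ! l) w \<noteq> 0" 
        unfolding D by (rule sum.not_neutral_contains_not_neutral)
      then have "w \<in> Cs ! k" "w \<in> Cs ! l" 
        using s0[OF BC[OF k], of w] s0[OF BC[OF l], of w] by auto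
      then have "Cs ! k = Cs ! l" by (rule component_eq[OF CsD(1)[OF k] CsD(1)[OF l]])
      then show "k = l" using k l Cs(2) by (simp add: nth_eq_iff_index_eq)
    next
      assume "k = l"
      obtain r where r: "r \<in> Cs ! k" by (rule component_class[OF CsD(1)[OF k]])
      have "(\<Sum>w\<in>verts S. s (Cs ! k) w * s (Cs ! k) w) > 0"
        using finV r subV[OF CsD(1)[OF k]] s1[OF BC[OF k] r]
        by (intro sum_pos2[of _ r]) auto
      then show "(transpose_mat B * B) $$ (k, l) \<noteq> 0" using D unfolding \<open>k = l\<close> by simp
    qed
  next
    fix x assume x: "x \<in> carrier_vec ?n" and Hx: "transpose_mat ?H *\<^sub>v x = 0\<^sub>v ?m"
      and Bx: "transpose_mat B *\<^sub>v x = 0\<^sub>v ?b"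
    \<comment> \<open>This reads the vector as a function on vertices by inverting the enumeration
      \<open>vs\<close>.\<close>
    define f where "f v = x $ (the_inv_into {..<?n} ((!) vs) v)" for v
    have "inj_on ((!) vs) {..<?n}" using vs by (auto simp: inj_on_nth enumerates_def)
    then have f: "f (vs ! i) = x $ i" if "i < ?n" for i
      unfolding f_def using that by (simp add: the_inv_into_f_f)
    have fe: "f u = sgn_of S {u, v} * f v" if uv: "{u, v} \<in> edges S" for u v
    proof -
      obtain k where k: "k < ?m" "es ! k = {u, v}"
        using es uv by (metis enumerates_def in_set_conv_nth)
      have "(\<Sum>w\<in>verts S. \<eta> w {u, v} * f w) = (transpose_mat ?H *\<^sub>v x) $ k"
        using x k f sum_enumerates[OF vs, of "\<lambda>w. \<eta> w {u, v} * f w"]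
        by (simp add: incidence_mat_def scalar_prod_def)
      also have "\<dots> = 0" using Hx k by simp
      finally show ?thesis using incidence_sum_eq_0_iff[OF S \<eta> uv, of f] by simp
    qed
    have "f w = 0" if w: "w \<in> verts S" for w
    proof (rule ccontr)
      assume nz: "f w \<noteq> 0"
      obtain C where C: "C \<in> components S" "w \<in> C" using component_of_vertex[OF w] by blast
      then have CB: "C \<in> ?BC" using balanced_if_nonzero[OF S C(1) fe C(2) nz] by simp
      then obtain k where k: "k < ?b" "Cs ! k = C" using Cs by (metis in_set_conv_nth)
      \<comment> \<open>Across an edge both factors pick up the same sign, which cancels: on a
        balanced component \<open>f\<close> is a multiple of the potential.\<close>
      have "s C v * f v = s C w * f w" if "v \<in> C" for v
      proof (rule component_constant[OF S C(1) _ that C(2)])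
        fix u v assume uv: "{u, v} \<in> edges S"
        then have "sgn_of S {u, v} \<in> {1, -1}" using S by (auto simp: signed_graph_def)
        then show "s C u * f u = s C v * f v" using fe[OF uv] se[OF CB uv] by auto
      qed
      \<comment> \<open>This sum is the entry of B^T x belonging to \<open>C\<close>, hence zero,
        which forces \<open>f w\<close> to vanish.\<close>
      then have "(\<Sum>v\<in>C. s C v * f v) = real (card C) * (s C w * f w)" by simp
      moreover have "(\<Sum>v\<in>C. s C v * f v) = (\<Sum>v\<in>verts S. s C v * f v)"
        using finV subV[OF C(1)] s0[OF CB] by (intro sum.mono_neutral_left) auto
      moreover have "(\<Sum>v\<in>verts S. s C v * f v) = (transpose_mat B *\<^sub>v x) $ k"
        using x k f sum_enumerates[OF vs, of "\<lambda>w. s C w * f w"] by (simp add: B_def scalar_prod_def)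
      moreover have "(transpose_mat B *\<^sub>v x) $ k = 0" using Bx k by simp
      moreover have "card C \<noteq> 0" using C(2) finite_subset[OF subV[OF C(1)] finV] by auto
      ultimately show False using nz s1[OF CB C(2)] by auto
    qed
    moreover have "vs ! i \<in> verts S" if "i < ?n" for i
      using vs nth_mem[OF that] by (simp add: enumerates_def)
    ultimately have "x $ i = 0" if "i < ?n" for i using f[OF that] that by simp
    then show "x = 0\<^sub>v ?n" using x by (intro eq_vecI) auto
  qed
  then show ?thesis by (simp add: b laplacian_mat_gram[OF S \<eta> vs es])
qed

section \<open>Spectrum and energy of the line graph\<close>

text \<open>The relation leaves nonzero entries in any order, but after one zero every entry is
  zero.\<close>

lemma sorted_zeros_last:
  fixes xs :: "'a :: zero list"
  assumes "sorted_wrt (\<lambda>x y. x = 0 \<longrightarrow> y = 0) xs"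
  shows "xs = filter (\<lambda>x. x \<noteq> 0) xs @ replicate (count (mset xs) 0) 0"
  using assms
proof (induction xs)
  case (Cons x xs)
  show ?case
  proof (cases "x = 0")
    case True
    then have "\<forall>y\<in>set xs. y = 0" using Cons.prems by simp
    then have "filter (\<lambda>x. x \<noteq> 0) xs = []" by (simp add: filter_empty_conv)
    then show ?thesis using True Cons by simp
  qed (use Cons in simp)
qed simp

theorem theorem3p9:
  fixes S :: "'a sgraph" and vs :: "'a list" and es :: "'a set list"
    and \<eta> :: "'a \<Rightarrow> 'a set \<Rightarrow> real" and ls :: "real list" and n m b :: nat
  assumes "signed_graph S"
    and "enumerates vs (verts S)" and "enumerates es (edges S)"
    and "is_incidence S \<eta>"
    and "n = card (verts S)" and "m = card (edges S)" and "b = num_balanced_components S"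
    and "mset ls = eigenvalues_of (laplacian_mat S vs)"
    and "sorted_wrt (\<lambda>x y. x = 0 \<longrightarrow> y = 0) ls"
  shows "length ls = n \<and> b \<le> n \<and> n \<le> m + b
    \<and> (\<forall>i<n - b. ls ! i > 0)
    \<and> (\<forall>i. n - b \<le> i \<and> i < n \<longrightarrow> ls ! i = 0)
    \<and> eigenvalues_of (adjacency_mat (line_graph S \<eta>) es) =
           mset (map (\<lambda>i. 2 - ls ! i) [0..<n - b]) + replicate_mset (m + b - n) 2
    \<and> (\<forall>i<n - b. 2 - ls ! i < 2)
    \<and> energy (line_graph S \<eta>) es =
           (\<Sum>i<n - b. \<bar>ls ! i - 2\<bar>) + 2 * (real m - real n + real b)"
proof -
  let ?H = "incidence_mat \<eta> vs es"
  let ?L = "?H * transpose_mat ?H" and ?K = "transpose_mat ?H * ?H"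
  have n: "length vs = n" and m: "length es = m"
    using assms(2,3,5,6) by (auto simp: enumerates_def dest: distinct_card)
  have H: "?H \<in> carrier_mat n m" by (simp add: incidence_mat_def n m)
  have L: "?L \<in> carrier_mat n n" and K: "?K \<in> carrier_mat m m" using H by auto
  have ev: "mset ls = eigenvalues_of ?L"
    using assms(8) laplacian_mat_gram[OF assms(1,4,2,3)] by simp
  have nz: "char_poly ?L \<noteq> 0" "char_poly ?K \<noteq> 0"
    using degree_monic_char_poly[OF L] degree_monic_char_poly[OF K] by auto
  have "transpose_mat ?L = ?L" using H by (simp add: transpose_mult[of _ n m _ n])
  then have len: "length ls = n"
    using size_eigenvalues_of_symmetric[OF L] ev by (metis size_mset)
  define ps where "ps = filter (\<lambda>x. x \<noteq> 0) ls"
  have "count (mset ls) 0 = b"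
    using count_0_laplacian[OF assms(1,4,2,3)] assms(7,8) by simp
  then have ls: "ls = ps @ replicate b 0"
    using sorted_zeros_last[OF assms(9)] by (simp add: ps_def)
  then have bn: "b \<le> n" and lps: "length ps = n - b" using len arg_cong[OF ls, of length] by simp_all
  have pos: "ls ! i > 0" if "i < n - b" for i
  proof -
    have "ls ! i = ps ! i" using that lps by (subst ls) (simp add: nth_append)
    then have "ls ! i \<in> set ps" using that lps by simp
    then have "ls ! i \<noteq> 0" "ls ! i \<in># mset ls" by (auto simp: ps_def)
    then show ?thesis
      using gram_root_nonneg[OF H, of "ls ! i"] nz(1) unfolding ev eigenvalues_of_def by simp
  qed
  have zero: "ls ! i = 0" if "n - b \<le> i" "i < n" for i
    using that lps bn by (subst ls) (simp add: nth_append)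
  have "monom 1 m * char_poly ?L = monom 1 n * char_poly ?K"
    using H by (intro char_poly_mult_commute) auto
  then have "replicate_mset m 0 + mset ls = replicate_mset n 0 + proots (char_poly ?K)"
    unfolding ev eigenvalues_of_def
    using nz by (metis proots_mult proots_monom monom_eq_0_iff one_neq_zero)
  \<comment> \<open>The zeros of \<open>ls\<close> are gathered with the \<open>m\<close> zeros
    coming from the power of x, so that all zeros on the left are explicit.\<close>
  then have K0: "replicate_mset (m + b) 0 + mset ps = replicate_mset n 0 + proots (char_poly ?K)"
    unfolding arg_cong[OF ls, of mset] by (simp add: replicate_mset_plus ac_simps)
  have ps0: "count (mset ps) 0 = 0" by (simp add: ps_def)
  \<comment> \<open>Comparing multiplicities of 0 gives the inequality, which keeps the natural
    subtraction in \<open>m + b - n\<close> from truncating.\<close>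
  have nmb: "n \<le> m + b"
    using arg_cong[OF K0, of "\<lambda>M. count M 0"] unfolding count_union ps0 by simp
  then have "replicate_mset (m + b) (0 :: real) = replicate_mset n 0 + replicate_mset (m + b - n) 0"
    by (simp flip: replicate_mset_plus)
  then have K1: "proots (char_poly ?K) = mset ps + replicate_mset (m + b - n) 0"
    using K0 by (simp add: ac_simps)
  have ps: "map (\<lambda>x. 2 - x) ps = map (\<lambda>i. 2 - ls ! i) [0..<n - b]"
    using lps by (intro nth_equalityI) (auto simp: ls nth_append)
  \<comment> \<open>The adjacency matrix is 2I - H^T H, so each eigenvalue x of H^T H becomes 2 - x;
    the zeros of \<open>?K\<close> supply the eigenvalue 2.\<close>
  have "eigenvalues_of (adjacency_mat (line_graph S \<eta>) es) = image_mset (\<lambda>x. 2 - x) (proots (char_poly ?K))"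
    unfolding eigenvalues_of_def adjacency_mat_line_graph[OF assms(1,4,2,3)] m
      char_poly_smult_one_minus[OF K]
    using proots_pcompose_linear[OF nz(2)] by (subst proots_smult) auto
  also have "\<dots> = mset (map (\<lambda>x. 2 - x) ps) + replicate_mset (m + b - n) 2"
    unfolding K1 by simp
  finally have spec: "eigenvalues_of (adjacency_mat (line_graph S \<eta>) es)
      = mset (map (\<lambda>i. 2 - ls ! i) [0..<n - b]) + replicate_mset (m + b - n) 2"
    unfolding ps .
  have "energy (line_graph S \<eta>) es
      = (\<Sum>i\<leftarrow>[0..<n - b]. \<bar>2 - ls ! i\<bar>) + 2 * real (m + b - n)"
    unfolding energy_def spec by (simp add: comp_def sum_mset_sum_list[symmetric] flip: mset_map)
  also have "(\<Sum>i\<leftarrow>[0..<n - b]. \<bar>2 - ls ! i\<bar>) = (\<Sum>i<n - b. \<bar>ls ! i - 2\<bar>)"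
    by (simp add: interv_sum_list_conv_sum_set_nat atLeast0LessThan abs_minus_commute)
  finally have "energy (line_graph S \<eta>) es = (\<Sum>i<n - b. \<bar>ls ! i - 2\<bar>) + 2 * (real m - real n + real b)"
    using nmb by (simp add: of_nat_diff)
  then show ?thesis using len bn nmb pos zero spec by simp
qed

end
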